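(* The function $f_n$ satisfies the following skein relation: for every $n\ge3$, every $1\le i\le n-2$ and all $\alpha,\beta\in T_n$, $$f_n(\alpha\, t_it_{i+1}t_i\,\beta)-f_n(\alpha\, t_{i+1}t_it_{i+1}\,\beta)=(x^2-1)\bigl(f_n(\alpha\, t_i\,\beta)-f_n(\alpha\, t_{i+1}\,\beta)\bigr).$$
   Context: For $n\ge1$ the twin group $T_n$ is the group with generators $t_1,\dots,t_{n-1}$ and relations $t_i^2=1$ for all $i$ and $t_it_j=t_jt_i$ for $|i-j|>1$ ($T_1$ is trivial). Let $\mathbb{Z}(x)$ denote the field of rational functions in $x$ (fraction field of $\mathbb{Z}[x]$). For $n\ge2$ and $1\le i\le n-1$ let $V_i$ be the $(n-1)\times(n-1)$ matrix that agrees with the identity matrix $I_{n-1}$ except in column $i$, where the $(i,i)$ entry is $-1$, the $(i-1,i)$ entry is $x$ (if $i\ge2$), and the $(i+1,i)$ entry is $x$ (if $i\le n-2$). Let $\psi_n:T_n\to GL_{n-1}(\mathbb{Z}(x))$ be the group homomorphism with $\psi_n(t_i)=V_i$. Let $U_m(z)$ be the Chebyshev polynomials of the second kind: $U_0=1$, $U_1=2z$, $U_m=2zU_{m-1}-U_{m-2}$. Define $f_n:T_n\to\mathbb{Z}(x)$ by $f_1(1)=1$ and, for $n\ge2$, $$f_n(\beta)=\frac{\det(\psi_n(\beta)-I_{n-1})}{(-x)^{n-1}U_{n-1}\left(\frac1x\right)}.$$ *)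

theory Defs
  imports "Jordan_Normal_Form.Determinant" "HOL-Library.FuncSet"
begin

section \<open>Groups given by generators and relations\<close>

text \<open>
  A letter \<open>(s, True)\<close> stands for the generator \<open>s\<close>, a letter \<open>(s, False)\<close> for its formal
  inverse. A relation \<open>u = v\<close> is represented by the pair \<open>(u, v)\<close>.
\<close>

type_synonym 'a word = "('a \<times> bool) list"

definition words :: "'a set \<Rightarrow> 'a word set" where
  "words S = lists (S \<times> UNIV)"

lemma words_simps [simp]:
  "[] \<in> words S"
  "(s, b) # w \<in> words S \<longleftrightarrow> s \<in> S \<and> w \<in> words S"
  "a # w \<in> words S \<longleftrightarrow> fst a \<in> S \<and> w \<in> words S"
  "u @ v \<in> words S \<longleftrightarrow> u \<in> words S \<and> v \<in> words S"
  unfolding words_def by (auto simp: mem_Times_iff)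

inductive pres_cong :: "'a set \<Rightarrow> ('a word \<times> 'a word) set \<Rightarrow> 'a word \<Rightarrow> 'a word \<Rightarrow> bool"
  for S R where
  pc_refl: "w \<in> words S \<Longrightarrow> pres_cong S R w w"
| pc_sym: "pres_cong S R u v \<Longrightarrow> pres_cong S R v u"
| pc_trans: "pres_cong S R u v \<Longrightarrow> pres_cong S R v w \<Longrightarrow> pres_cong S R u w"
| pc_append: "pres_cong S R u u' \<Longrightarrow> pres_cong S R v v' \<Longrightarrow> pres_cong S R (u @ v) (u' @ v')"
| pc_cancel: "s \<in> S \<Longrightarrow> pres_cong S R [(s, b), (s, \<not> b)] []"
| pc_rel: "(u, v) \<in> R \<Longrightarrow> u \<in> words S \<Longrightarrow> v \<in> words S \<Longrightarrow> pres_cong S R u v"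

definition pres_class :: "'a set \<Rightarrow> ('a word \<times> 'a word) set \<Rightarrow> 'a word \<Rightarrow> 'a word set" where
  "pres_class S R w = {v. pres_cong S R w v}"

definition presented_group :: "'a set \<Rightarrow> ('a word \<times> 'a word) set \<Rightarrow> 'a word set monoid" where
  "presented_group S R =
     \<lparr>carrier = pres_class S R ` words S,
      mult = (\<lambda>X Y. \<Union>u\<in>X. \<Union>v\<in>Y. pres_class S R (u @ v)),
      one = pres_class S R []\<rparr>"

lemma pres_cong_words: "pres_cong S R u v \<Longrightarrow> u \<in> words S \<and> v \<in> words S"
  by (induction rule: pres_cong.induct) auto

lemma pres_class_eqI: "pres_cong S R u v \<Longrightarrow> pres_class S R u = pres_class S R v"
  unfolding pres_class_def by (blast intro: pc_sym pc_trans)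

lemma pres_class_eq_iff:
  assumes "u \<in> words S"
  shows "pres_class S R u = pres_class S R v \<longleftrightarrow> pres_cong S R u v"
proof
  assume "pres_class S R u = pres_class S R v"
  moreover have "u \<in> pres_class S R u" using assms by (simp add: pres_class_def pc_refl)
  ultimately show "pres_cong S R u v" by (auto simp: pres_class_def intro: pc_sym)
qed (rule pres_class_eqI)

lemma presented_group_mult:
  assumes "u \<in> words S" "v \<in> words S"
  shows "pres_class S R u \<otimes>\<^bsub>presented_group S R\<^esub> pres_class S R v = pres_class S R (u @ v)"
proof -
  have 1: "pres_class S R (u' @ v') = pres_class S R (u @ v)"
    if "u' \<in> pres_class S R u" "v' \<in> pres_class S R v" for u' v'
  proof (rule pres_class_eqI)
    show "pres_cong S R (u' @ v') (u @ v)"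
      using that unfolding pres_class_def mem_Collect_eq by (intro pc_append) (erule pc_sym)+
  qed
  have 2: "u \<in> pres_class S R u" "v \<in> pres_class S R v"
    using assms by (auto simp: pres_class_def intro: pc_refl)
  have "pres_class S R u \<otimes>\<^bsub>presented_group S R\<^esub> pres_class S R v
      = (\<Union>u'\<in>pres_class S R u. \<Union>v'\<in>pres_class S R v. pres_class S R (u' @ v'))"
    by (simp add: presented_group_def)
  also have "\<dots> = (\<Union>u'\<in>pres_class S R u. \<Union>v'\<in>pres_class S R v. pres_class S R (u @ v))"
    by (intro SUP_cong refl 1)
  also have "\<dots> = pres_class S R (u @ v)" using 2 by blast
  finally show ?thesis .
qed

abbreviation inv_word :: "'a word \<Rightarrow> 'a word" where
  "inv_word w \<equiv> rev (map (\<lambda>(s, b). (s, \<not> b)) w)"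

lemma inv_word_words: "w \<in> words S \<Longrightarrow> inv_word w \<in> words S"
  by (induction w) auto

lemma inv_word_cancel: "w \<in> words S \<Longrightarrow> pres_cong S R (inv_word w @ w) []"
proof (induction w)
  case Nil
  show ?case by (simp add: pc_refl)
next
  case (Cons a w)
  obtain s b where a: "a = (s, b)" by force
  have s: "s \<in> S" and w: "w \<in> words S" using Cons.prems a by auto
  have "pres_cong S R [(s, \<not> b), (s, b)] []" using pc_cancel[OF s, of R "\<not> b"] by simp
  then have "pres_cong S R (inv_word w @ ([(s, \<not> b), (s, b)] @ w)) (inv_word w @ ([] @ w))"
    by (intro pc_append pc_refl inv_word_words w)
  with Cons.IH[OF w] show ?case by (auto simp: a intro: pc_trans)
qed

lemma presented_group_group: "group (presented_group S R)"
proof (rule groupI)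
  let ?G = "presented_group S R"
  have carr: "carrier ?G = pres_class S R ` words S" by (simp add: presented_group_def)
  have one: "\<one>\<^bsub>?G\<^esub> = pres_class S R []" by (simp add: presented_group_def)
  show "x \<otimes>\<^bsub>?G\<^esub> y \<in> carrier ?G" if "x \<in> carrier ?G" "y \<in> carrier ?G" for x y
    using that unfolding carr by (auto simp: presented_group_mult)
  show "\<one>\<^bsub>?G\<^esub> \<in> carrier ?G" by (auto simp: carr one)
  show "x \<otimes>\<^bsub>?G\<^esub> y \<otimes>\<^bsub>?G\<^esub> z = x \<otimes>\<^bsub>?G\<^esub> (y \<otimes>\<^bsub>?G\<^esub> z)"
    if "x \<in> carrier ?G" "y \<in> carrier ?G" "z \<in> carrier ?G" for x y z
    using that unfolding carr by (auto simp: presented_group_mult)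
  show "\<one>\<^bsub>?G\<^esub> \<otimes>\<^bsub>?G\<^esub> x = x" if "x \<in> carrier ?G" for x
    using that unfolding carr one by (auto simp: presented_group_mult)
  show "\<exists>y\<in>carrier ?G. y \<otimes>\<^bsub>?G\<^esub> x = \<one>\<^bsub>?G\<^esub>" if "x \<in> carrier ?G" for x
  proof -
    obtain w where w: "w \<in> words S" "x = pres_class S R w"
      using \<open>x \<in> carrier ?G\<close> unfolding carr by blast
    have "pres_class S R (inv_word w) \<otimes>\<^bsub>?G\<^esub> x = \<one>\<^bsub>?G\<^esub>"
      unfolding w(2) one presented_group_mult[OF inv_word_words[OF w(1)] w(1)]
      by (rule pres_class_eqI[OF inv_word_cancel[OF w(1)]])
    then show ?thesis using inv_word_words[OF w(1)] unfolding carr by blast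
  qed
qed

fun eval_word :: "('b, 'c) monoid_scheme \<Rightarrow> ('a \<Rightarrow> 'b) \<Rightarrow> 'a word \<Rightarrow> 'b" where
  "eval_word G g [] = \<one>\<^bsub>G\<^esub>"
| "eval_word G g ((s, b) # w) = (if b then g s else inv\<^bsub>G\<^esub> (g s)) \<otimes>\<^bsub>G\<^esub> eval_word G g w"

context
  fixes G (structure) and g :: "'a \<Rightarrow> 'b" and S :: "'a set" and R :: "('a word \<times> 'a word) set"
  assumes G: "group G"
    and g: "\<And>s. s \<in> S \<Longrightarrow> g s \<in> carrier G"
    and rel: "\<And>u v. (u, v) \<in> R \<Longrightarrow> u \<in> words S \<Longrightarrow> v \<in> words S \<Longrightarrow> eval_word G g u = eval_word G g v"
begin

interpretation group G by (rule G)

lemma eval_word_closed: "w \<in> words S \<Longrightarrow> eval_word G g w \<in> carrier G"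
proof (induction w)
  case (Cons a w)
  obtain s b where a: "a = (s, b)" by force
  have "g s \<in> carrier G" "eval_word G g w \<in> carrier G" using Cons g by (simp_all add: a)
  then show ?case by (simp add: a)
qed simp

lemma eval_word_append:
  "u \<in> words S \<Longrightarrow> v \<in> words S \<Longrightarrow> eval_word G g (u @ v) = eval_word G g u \<otimes> eval_word G g v"
proof (induction u)
  case Nil
  then show ?case by (simp add: eval_word_closed)
next
  case (Cons a u)
  obtain s b where a: "a = (s, b)" by force
  have "g s \<in> carrier G" "eval_word G g u \<in> carrier G" "eval_word G g v \<in> carrier G"
    using Cons.prems g by (simp_all add: a eval_word_closed)
  moreover have "eval_word G g (u @ v) = eval_word G g u \<otimes> eval_word G g v"
    using Cons by simp
  ultimately show ?case by (simp add: a m_assoc)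
qed

lemma eval_word_cong: "pres_cong S R u v \<Longrightarrow> eval_word G g u = eval_word G g v"
proof (induction rule: pres_cong.induct)
  case (pc_append u u' v v')
  then show ?case by (simp add: eval_word_append pres_cong_words)
next
  case (pc_cancel s b)
  then have "g s \<in> carrier G" by (rule g)
  then show ?case by simp
next
  case (pc_rel u v)
  then show ?case by (rule rel)
qed auto

lemma presented_group_hom_eval:
  assumes h: "h \<in> hom (presented_group S R) G"
    and gen: "\<And>s. s \<in> S \<Longrightarrow> h (pres_class S R [(s, True)]) = g s"
    and w: "w \<in> words S"
  shows "h (pres_class S R w) = eval_word G g w"
proof -
  let ?P = "presented_group S R"
  interpret P: group ?P by (rule presented_group_group)
  interpret H: group_hom ?P G h
    using h by (unfold_locales) (auto simp: group_hom_axioms_def)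
  have carr: "pres_class S R u \<in> carrier ?P" if "u \<in> words S" for u
    using that by (auto simp: presented_group_def)
  show ?thesis
    using w
  proof (induction w)
    case Nil
    show ?case using H.hom_one by (simp add: presented_group_def)
  next
    case (Cons a w)
    obtain s b where a: "a = (s, b)" by force
    have s: "s \<in> S" and w: "w \<in> words S" using Cons.prems a by auto
    have sw: "[(s, c)] \<in> words S" for c using s by auto
    have one: "\<one>\<^bsub>?P\<^esub> = pres_class S R []" by (simp add: presented_group_def)
    have "pres_class S R [(s, False)] \<otimes>\<^bsub>?P\<^esub> pres_class S R [(s, True)] = \<one>\<^bsub>?P\<^esub>"
      using pc_cancel[OF s, of R False] unfolding presented_group_mult[OF sw sw] one
      by (intro pres_class_eqI) simp
    then have "pres_class S R [(s, False)] = inv\<^bsub>?P\<^esub> pres_class S R [(s, True)]"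
      by (simp only: P.inv_equality[OF _ carr[OF sw] carr[OF sw]])
    then have "h (pres_class S R [(s, False)]) = inv g s"
      using carr[OF sw] by (simp add: gen[OF s])
    then have hs: "h (pres_class S R [(s, b)]) = (if b then g s else inv g s)"
      by (simp add: gen[OF s])
    have "h (pres_class S R (a # w)) = h (pres_class S R [(s, b)] \<otimes>\<^bsub>?P\<^esub> pres_class S R w)"
      by (simp add: presented_group_mult[OF sw w] a)
    also have "\<dots> = h (pres_class S R [(s, b)]) \<otimes> h (pres_class S R w)"
      by (rule H.hom_mult[OF carr[OF sw] carr[OF w]])
    finally show ?case using Cons.IH[OF w] hs by (simp add: a)
  qed
qed

lemma presented_group_ex1_hom:
  "\<exists>!h. h \<in> hom (presented_group S R) G \<and> h \<in> extensional (carrier (presented_group S R))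
      \<and> (\<forall>s\<in>S. h (pres_class S R [(s, True)]) = g s)"
proof -
  let ?P = "presented_group S R"
  have carr: "carrier ?P = pres_class S R ` words S" by (simp add: presented_group_def)
  define h where "h = restrict (\<lambda>X. eval_word G g (SOME w. w \<in> X)) (carrier ?P)"
  have h: "h (pres_class S R w) = eval_word G g w" if "w \<in> words S" for w
  proof -
    have "w \<in> pres_class S R w" using that by (simp add: pres_class_def pc_refl)
    then have "(SOME v. v \<in> pres_class S R w) \<in> pres_class S R w" by (rule someI)
    then have "pres_cong S R w (SOME v. v \<in> pres_class S R w)"
      by (simp only: pres_class_def mem_Collect_eq)
    then have "eval_word G g (SOME v. v \<in> pres_class S R w) = eval_word G g w"
      by (rule eval_word_cong[symmetric])
    then show ?thesis using that by (simp add: h_def carr)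
  qed
  have ext: "h \<in> extensional (carrier ?P)" by (simp add: h_def)
  have hom: "h \<in> hom ?P G"
  proof (rule homI)
    show "h x \<in> carrier G" if "x \<in> carrier ?P" for x
      using that unfolding carr by (auto simp: h eval_word_closed)
    show "h (x \<otimes>\<^bsub>?P\<^esub> y) = h x \<otimes> h y" if xy: "x \<in> carrier ?P" "y \<in> carrier ?P" for x y
    proof -
      obtain u v where uv: "u \<in> words S" "x = pres_class S R u" "v \<in> words S" "y = pres_class S R v"
        using xy unfolding carr by blast
      then have "u @ v \<in> words S" by auto
      with uv show ?thesis by (simp add: presented_group_mult h eval_word_append)
    qed
  qed
  have gen: "h (pres_class S R [(s, True)]) = g s" if "s \<in> S" for s
  proof -
    have "[(s, True)] \<in> words S" using that by auto
    then show ?thesis using g[OF that] by (simp add: h)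
  qed
  show ?thesis
  proof (rule ex1I[of _ h])
    show "h \<in> hom ?P G \<and> h \<in> extensional (carrier ?P)
        \<and> (\<forall>s\<in>S. h (pres_class S R [(s, True)]) = g s)"
      using hom gen ext by blast
  next
    fix k
    assume k: "k \<in> hom ?P G \<and> k \<in> extensional (carrier ?P)
        \<and> (\<forall>s\<in>S. k (pres_class S R [(s, True)]) = g s)"
    show "k = h"
    proof (rule extensionalityI[of _ "carrier ?P"])
      show "k x = h x" if x: "x \<in> carrier ?P" for x
      proof -
        obtain w where w: "w \<in> words S" "x = pres_class S R w"
          using x unfolding carr by blast
        have "k (pres_class S R w) = eval_word G g w"
          using k w(1) by (intro presented_group_hom_eval) auto
        then show ?thesis using w h by simp
      qed
    qed (use k ext in blast)+
  qed
qed

end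


section \<open>Twin groups\<close>

definition twin_rels :: "nat \<Rightarrow> (nat word \<times> nat word) set" where
  "twin_rels n =
     {([(i, True), (i, True)], []) | i. i \<in> {1..n - 1}} \<union>
     {([(i, True), (j, True)], [(j, True), (i, True)]) | i j.
        i \<in> {1..n - 1} \<and> j \<in> {1..n - 1} \<and> \<bar>int i - int j\<bar> > 1}"

definition twin_group :: "nat \<Rightarrow> nat word set monoid" where
  "twin_group n = presented_group {1..n - 1} (twin_rels n)"

definition twin_gen :: "nat \<Rightarrow> nat \<Rightarrow> nat word set" where
  "twin_gen n i = pres_class {1..n - 1} (twin_rels n) [(i, True)]"

lemma twin_group_group: "group (twin_group n)"
  unfolding twin_group_def by (rule presented_group_group)

lemma twin_gen_carrier: "i \<in> {1..n - 1} \<Longrightarrow> twin_gen n i \<in> carrier (twin_group n)"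
  by (auto simp: twin_gen_def twin_group_def presented_group_def)


section \<open>The representation\<close>

type_synonym ratfun = "int poly fract"

definition ratfun_X :: ratfun where
  "ratfun_X = to_fract [:0, 1:]"

text \<open>Rows and columns of library matrices are indexed from 0: column \<open>c\<close> here is the
  column \<open>c + 1\<close> of \<open>V\<^sub>i\<close>, and likewise for rows.\<close>

definition twin_mat :: "nat \<Rightarrow> nat \<Rightarrow> ratfun mat" where
  "twin_mat n i = mat (n - 1) (n - 1) (\<lambda>(r, c).
     if c + 1 = i then
       (if r + 1 = i then - 1 else if r + 1 = i - 1 \<or> r + 1 = i + 1 then ratfun_X else 0)
     else if r = c then 1 else 0)"

definition GL :: "nat \<Rightarrow> ratfun mat monoid" where
  "GL m = units_of (ring_mat TYPE(ratfun) m ())"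

definition twin_rep :: "nat \<Rightarrow> nat word set \<Rightarrow> ratfun mat" where
  "twin_rep n = (THE h. h \<in> hom (twin_group n) (GL (n - 1))
      \<and> h \<in> extensional (carrier (twin_group n))
      \<and> (\<forall>i\<in>{1..n - 1}. h (twin_gen n i) = twin_mat n i))"

lemma GL_group: "group (GL m)"
proof -
  interpret ring "ring_mat TYPE(ratfun) m ()" by (rule ring_mat)
  show ?thesis unfolding GL_def by (rule units_group)
qed

lemma GL_simps:
  "\<one>\<^bsub>GL m\<^esub> = 1\<^sub>m m" "A \<otimes>\<^bsub>GL m\<^esub> B = A * B"
  by (simp_all add: GL_def units_of_def ring_mat_simps)

lemma twin_mat_carrier: "twin_mat n i \<in> carrier_mat (n - 1) (n - 1)"
  by (simp add: twin_mat_def)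

definition twin_coeff :: "nat \<Rightarrow> nat \<Rightarrow> ratfun" where
  "twin_coeff i r =
     (if r + 1 = i then - 2 else if r + 1 = i - 1 \<or> r + 1 = i + 1 then ratfun_X else 0)"

lemma twin_mat_index:
  assumes "i \<in> {1..n - 1}" "r < n - 1" "c < n - 1"
  shows "twin_mat n i $$ (r, c) = of_bool (r = c) + twin_coeff i r * of_bool (i - 1 = c)"
  using assms by (auto simp: twin_mat_def twin_coeff_def)

lemma twin_mat_mult_index:
  assumes i: "i \<in> {1..n - 1}" and A: "A \<in> carrier_mat (n - 1) (n - 1)"
    and r: "r < n - 1" and c: "c < n - 1"
  shows "(twin_mat n i * A) $$ (r, c) = A $$ (r, c) + twin_coeff i r * A $$ (i - 1, c)"
proof -
  have i1: "i - 1 < n - 1" using i by auto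
  have "(twin_mat n i * A) $$ (r, c) = (\<Sum>k<n - 1. twin_mat n i $$ (r, k) * A $$ (k, c))"
    using A r c twin_mat_carrier[of n i] by (simp add: scalar_prod_def atLeast0LessThan)
  also have "\<dots> = (\<Sum>k<n - 1. (if r = k then A $$ (k, c) else 0)
      + (if i - 1 = k then twin_coeff i r * A $$ (k, c) else 0))"
    by (intro sum.cong refl) (simp add: twin_mat_index[OF i r] distrib_right)
  also have "\<dots> = A $$ (r, c) + twin_coeff i r * A $$ (i - 1, c)"
    unfolding sum.distrib using r i1 by simp
  finally show ?thesis .
qed

lemma twin_mat_square:
  assumes i: "i \<in> {1..n - 1}"
  shows "twin_mat n i * twin_mat n i = 1\<^sub>m (n - 1)"
proof (rule eq_matI)
  fix r c assume "r < dim_row (1\<^sub>m (n - 1) :: ratfun mat)" "c < dim_col (1\<^sub>m (n - 1) :: ratfun mat)"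
  then have r: "r < n - 1" and c: "c < n - 1" by auto
  have i1: "i - 1 < n - 1" using i by auto
  have "twin_coeff i (i - 1) = - 2" using i by (simp add: twin_coeff_def)
  then have "(twin_mat n i * twin_mat n i) $$ (r, c) = of_bool (r = c)"
    unfolding twin_mat_mult_index[OF i twin_mat_carrier r c] twin_mat_index[OF i r c]
      twin_mat_index[OF i i1 c] by (simp add: algebra_simps)
  then show "(twin_mat n i * twin_mat n i) $$ (r, c) = 1\<^sub>m (n - 1) $$ (r, c)"
    using r c by simp
qed (use twin_mat_carrier[of n i] in auto)

lemma twin_mat_commute:
  assumes i: "i \<in> {1..n - 1}" and j: "j \<in> {1..n - 1}" and ij: "\<bar>int i - int j\<bar> > 1"
  shows "twin_mat n i * twin_mat n j = twin_mat n j * twin_mat n i"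
proof (rule eq_matI)
  fix r c assume "r < dim_row (twin_mat n j * twin_mat n i)" "c < dim_col (twin_mat n j * twin_mat n i)"
  then have r: "r < n - 1" and c: "c < n - 1" by (auto simp: twin_mat_def)
  have i1: "i - 1 < n - 1" and j1: "j - 1 < n - 1" using i j by auto
  have "twin_coeff i (j - 1) = 0" "twin_coeff j (i - 1) = 0"
    using i j ij by (simp_all add: twin_coeff_def) linarith+
  then show "(twin_mat n i * twin_mat n j) $$ (r, c) = (twin_mat n j * twin_mat n i) $$ (r, c)"
    unfolding twin_mat_mult_index[OF i twin_mat_carrier r c] twin_mat_index[OF i r c]
      twin_mat_mult_index[OF j twin_mat_carrier r c] twin_mat_index[OF j r c]
      twin_mat_index[OF i j1 c] twin_mat_index[OF j i1 c]
    by (simp add: algebra_simps)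
qed (use twin_mat_carrier[of n i] twin_mat_carrier[of n j] in auto)

lemma twin_mat_GL:
  assumes i: "i \<in> {1..n - 1}"
  shows "twin_mat n i \<in> carrier (GL (n - 1))"
  using twin_mat_square[OF i] twin_mat_carrier[of n i]
  by (auto simp: GL_def units_of_def Units_def ring_mat_simps)

lemma twin_rep_ex1:
  "\<exists>!h. h \<in> hom (twin_group n) (GL (n - 1)) \<and> h \<in> extensional (carrier (twin_group n))
      \<and> (\<forall>i\<in>{1..n - 1}. h (twin_gen n i) = twin_mat n i)"
  unfolding twin_group_def twin_gen_def
proof (rule presented_group_ex1_hom[OF GL_group twin_mat_GL])
  fix u v assume uv: "(u, v) \<in> twin_rels n"
  have "twin_mat n i * 1\<^sub>m (n - 1) = twin_mat n i" for i
    by (rule right_mult_one_mat[OF twin_mat_carrier])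
  then show "eval_word (GL (n - 1)) (twin_mat n) u = eval_word (GL (n - 1)) (twin_mat n) v"
    using uv twin_mat_square[of _ n] twin_mat_commute[of _ n]
    unfolding twin_rels_def by (auto simp del: One_nat_def simp add: GL_simps)
qed

lemma twin_rep_hom: "twin_rep n \<in> hom (twin_group n) (GL (n - 1))"
  and twin_rep_gen: "i \<in> {1..n - 1} \<Longrightarrow> twin_rep n (twin_gen n i) = twin_mat n i"
  using theI'[OF twin_rep_ex1[of n]] unfolding twin_rep_def by auto


section \<open>The invariant\<close>

fun cheb_U :: "nat \<Rightarrow> 'a::comm_ring_1 poly" where
  "cheb_U 0 = 1"
| "cheb_U (Suc 0) = [:0, 2:]"
| "cheb_U (Suc (Suc m)) = [:0, 2:] * cheb_U (Suc m) - cheb_U m"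

definition twin_f :: "nat \<Rightarrow> nat word set \<Rightarrow> ratfun" where
  "twin_f n \<beta> = (if n = 1 then 1
     else det (twin_rep n \<beta> - 1\<^sub>m (n - 1))
            / ((- ratfun_X) ^ (n - 1) * poly (cheb_U (n - 1)) (1 / ratfun_X)))"

text \<open>The denominator does not vanish, so the division is a genuine one.\<close>

lemma ratfun_X_nonzero: "ratfun_X \<noteq> 0"
  by (simp add: ratfun_X_def)

lemma cheb_U_denominator:
  "\<exists>p :: int poly. poly p 0 = 2 ^ m \<and> ratfun_X ^ m * poly (cheb_U m) (1 / ratfun_X) = to_fract p"
proof (induction m rule: cheb_U.induct)
  case 1
  show ?case by (rule exI[of _ 1]) simp
next
  case 2
  have "to_fract (2 :: int poly) = 2"
    using to_fract_add[of "1 :: int poly" 1] by simp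
  then show ?case by (intro exI[of _ 2]) (simp add: ratfun_X_nonzero)
next
  case (3 m)
  then obtain p q :: "int poly" where p: "poly p 0 = 2 ^ Suc m"
      "ratfun_X ^ Suc m * poly (cheb_U (Suc m)) (1 / ratfun_X) = to_fract p"
    and q: "poly q 0 = 2 ^ m" "ratfun_X ^ m * poly (cheb_U m) (1 / ratfun_X) = to_fract q"
    by blast
  have 2: "to_fract (2 :: int poly) = 2"
    using to_fract_add[of "1 :: int poly" 1] by simp
  have "ratfun_X ^ Suc (Suc m) * poly (cheb_U (Suc (Suc m))) (1 / ratfun_X)
     = 2 * (ratfun_X ^ Suc m * poly (cheb_U (Suc m)) (1 / ratfun_X))
       - ratfun_X * ratfun_X * (ratfun_X ^ m * poly (cheb_U m) (1 / ratfun_X))"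
    using ratfun_X_nonzero by (simp add: field_simps)
  also have "\<dots> = to_fract (2 * p - [:0, 1:] * [:0, 1:] * q)"
    unfolding p(2) q(2) by (simp only: ratfun_X_def to_fract_mult to_fract_diff 2)
  finally show ?case
    using p(1) by (intro exI[of _ "2 * p - [:0, 1:] * [:0, 1:] * q"]) simp
qed

lemma twin_f_denominator_nonzero:
  "(- ratfun_X) ^ m * poly (cheb_U m) (1 / ratfun_X) \<noteq> 0"
proof -
  obtain p :: "int poly" where "poly p 0 = 2 ^ m"
    "ratfun_X ^ m * poly (cheb_U m) (1 / ratfun_X) = to_fract p"
    using cheb_U_denominator by blast
  then have "ratfun_X ^ m * poly (cheb_U m) (1 / ratfun_X) \<noteq> 0" by auto
  then show ?thesis using ratfun_X_nonzero by auto
qed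

end

theory Submission
  imports Defs
begin

text \<open>
  Write \<open>V\<^sub>i = I + u\<^sub>i e\<^sub>i\<close> with a column \<open>u\<^sub>i\<close> and the unit row \<open>e\<^sub>i\<close>. For adjacent
  \<open>i\<close> and \<open>j\<close> the relations \<open>e\<^sub>i u\<^sub>i = -2\<close> and \<open>e\<^sub>i u\<^sub>j = e\<^sub>j u\<^sub>i = x\<close> make
  both triple products rank-one perturbations of the identity as well (\<open>twin_mat_triple\<close>):
  \<open>V\<^sub>i V\<^sub>j V\<^sub>i = I + (x u\<^sub>i + u\<^sub>j) (x e\<^sub>i + e\<^sub>j)\<close> and
  \<open>V\<^sub>j V\<^sub>i V\<^sub>j = I + (u\<^sub>i + x u\<^sub>j) (e\<^sub>i + x e\<^sub>j)\<close>.

  If \<open>M = I + u w\<close> has this form, then \<open>A M B - I = (A B - I) + (A u) (w B)\<close>: all four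
  determinants in the skein relation are those of rank-one perturbations of the same matrix
  \<open>A B - I\<close>, where \<open>A\<close> and \<open>B\<close> are the images of \<open>\<alpha>\<close> and \<open>\<beta>\<close>. The increment
  \<open>L(u, w) = det (C + u w) - det C\<close> is bilinear in \<open>u\<close> and \<open>w\<close>, because
  \<open>det (C + u w)\<close> is the determinant of \<open>C\<close> bordered by the row \<open>w\<close> and the column
  \<open>-u\<close>. Expanding \<open>L\<close> at the two triple products, the mixed terms
  \<open>x L(u\<^sub>i, e\<^sub>j) + x L(u\<^sub>j, e\<^sub>i)\<close> agree and cancel, whereas the coefficients of
  \<open>L(u\<^sub>i, e\<^sub>i)\<close> and \<open>L(u\<^sub>j, e\<^sub>j)\<close> are \<open>x\<^sup>2\<close> and \<open>1\<close> in one and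
  \<open>1\<close> and \<open>x\<^sup>2\<close> in the other. The difference is
  \<open>(x\<^sup>2 - 1) (L(u\<^sub>i, e\<^sub>i) - L(u\<^sub>j, e\<^sub>j))\<close>. The denominator of \<open>twin_f\<close> depends
  only on \<open>n\<close>, so the relation between the determinants is the skein relation.
\<close>

section \<open>Rank-one perturbations of a determinant\<close>

text \<open>
  Adding \<open>U\<close> times the top row to the rows below it clears the first column and leaves
  \<open>B + U * W\<close> in the corner. The point of the bordered form is that \<open>W\<close> is now a row of the
  matrix, where the determinant is visibly linear.
\<close>

lemma det_bordered:
  fixes B :: "'a::idom mat"
  assumes B: "B \<in> carrier_mat m m" and U: "U \<in> carrier_mat m 1" and W: "W \<in> carrier_mat 1 m"
  shows "det (four_block_mat (1\<^sub>m 1) W (- U) B) = det (B + U * W)"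
proof -
  let ?P = "four_block_mat (1\<^sub>m 1) (0\<^sub>m 1 m) U (1\<^sub>m m)"
  let ?N = "four_block_mat (1\<^sub>m 1) W (- U) B"
  have UW: "U * W \<in> carrier_mat m m" using U W by simp
  have blocks: "1\<^sub>m 1 * 1\<^sub>m 1 + 0\<^sub>m 1 m * (- U) = 1\<^sub>m 1" "1\<^sub>m 1 * W + 0\<^sub>m 1 m * B = W"
    "U * 1\<^sub>m 1 + 1\<^sub>m m * (- U) = 0\<^sub>m m 1" "U * W + 1\<^sub>m m * B = B + U * W"
    using B U W comm_add_mat[OF B UW] by auto
  have "?P * ?N = four_block_mat (1\<^sub>m 1 * 1\<^sub>m 1 + 0\<^sub>m 1 m * (- U)) (1\<^sub>m 1 * W + 0\<^sub>m 1 m * B)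
      (U * 1\<^sub>m 1 + 1\<^sub>m m * (- U)) (U * W + 1\<^sub>m m * B)"
    using U by (intro mult_four_block_mat[OF one_carrier_mat zero_carrier_mat U one_carrier_mat
          one_carrier_mat W _ B]) simp
  also have "\<dots> = four_block_mat (1\<^sub>m 1) W (0\<^sub>m m 1) (B + U * W)"
    unfolding blocks ..
  finally have "?P * ?N = four_block_mat (1\<^sub>m 1) W (0\<^sub>m m 1) (B + U * W)" .
  moreover have "det (four_block_mat (1\<^sub>m 1) W (0\<^sub>m m 1) (B + U * W)) = det (B + U * W)"
    using det_four_block_mat_lower_left_zero[OF one_carrier_mat[of 1] W refl, of "B + U * W"] B UW
    by simp
  moreover have "det (?P * ?N) = det ?P * det ?N"
    using B U W by (intro det_mult[of _ "1 + m"] four_block_carrier_mat) auto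
  moreover have "det ?P = 1"
    using det_four_block_mat_upper_right_zero[OF one_carrier_mat[of 1] refl U one_carrier_mat] by simp
  ultimately show ?thesis by simp
qed

text \<open>
  In the Laplace expansion of the bordered matrix along its first row, the entries of \<open>W\<close>
  appear as coefficients of minors that are independent of \<open>W\<close>; the corner entry contributes
  the constant \<open>det B\<close>.
\<close>

lemma det_rank_one_linear_right:
  fixes B :: "'a::idom mat"
  assumes B: "B \<in> carrier_mat m m" and U: "U \<in> carrier_mat m 1"
    and W: "W \<in> carrier_mat 1 m" and W': "W' \<in> carrier_mat 1 m"
  shows "det (B + U * (a \<cdot>\<^sub>m W + b \<cdot>\<^sub>m W')) - det B
    = a * (det (B + U * W) - det B) + b * (det (B + U * W') - det B)"
proof -
  define N where "N = (\<lambda>Z. four_block_mat (1\<^sub>m 1) Z (- U) B)"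
  define k where "k = (\<lambda>j. cofactor (N (0\<^sub>m 1 m)) 0 j)"
  have expand: "det (B + U * Z) = k 0 + (\<Sum>j<m. Z $$ (0, j) * k (Suc j))"
    if Z: "Z \<in> carrier_mat 1 m" for Z
  proof -
    have N: "N Z \<in> carrier_mat (Suc m) (Suc m)"
      using four_block_carrier_mat[OF one_carrier_mat[of 1] B] unfolding N_def by simp
    have k: "cofactor (N Z) 0 j = k j" if "j < Suc m" for j
    proof -
      have "mat_delete (N Z) 0 j = mat_delete (N (0\<^sub>m 1 m)) 0 j"
        using B U Z that by (intro eq_matI) (auto simp: N_def mat_delete_def)
      then show ?thesis by (simp add: k_def cofactor_def)
    qed
    have "det (B + U * Z) = det (N Z)"
      unfolding N_def by (rule det_bordered[OF B U Z, symmetric])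
    also have "\<dots> = (\<Sum>j<Suc m. N Z $$ (0, j) * k j)"
      unfolding laplace_expansion_row[OF N zero_less_Suc] by (intro sum.cong refl) (simp add: k)
    also have "\<dots> = k 0 + (\<Sum>j<m. Z $$ (0, j) * k (Suc j))"
      unfolding sum.lessThan_Suc_shift using B Z
      by (intro arg_cong2[of _ _ _ _ "(+)"] sum.cong) (auto simp: N_def)
    finally show ?thesis .
  qed
  have 0: "det B = k 0"
    using expand[of "0\<^sub>m 1 m"] B U by simp
  have "(\<Sum>j<m. (a \<cdot>\<^sub>m W + b \<cdot>\<^sub>m W') $$ (0, j) * k (Suc j))
      = (\<Sum>j<m. a * (W $$ (0, j) * k (Suc j)) + b * (W' $$ (0, j) * k (Suc j)))"
    using W W' by (intro sum.cong refl) (auto simp: algebra_simps)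
  then show ?thesis
    unfolding 0 using expand[OF W] expand[OF W'] expand[of "a \<cdot>\<^sub>m W + b \<cdot>\<^sub>m W'"] W W'
    by (simp add: sum.distrib sum_distrib_left)
qed

text \<open>Transposition exchanges the roles of the column and the row.\<close>

lemma det_rank_one_linear_left:
  fixes B :: "'a::idom mat"
  assumes B: "B \<in> carrier_mat m m" and U: "U \<in> carrier_mat m 1"
    and U': "U' \<in> carrier_mat m 1" and W: "W \<in> carrier_mat 1 m"
  shows "det (B + (a \<cdot>\<^sub>m U + b \<cdot>\<^sub>m U') * W) - det B
    = a * (det (B + U * W) - det B) + b * (det (B + U' * W) - det B)"
proof -
  have tr: "det (B + Z * W) = det (B\<^sup>T + W\<^sup>T * Z\<^sup>T)" if "Z \<in> carrier_mat m 1" for Z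
  proof -
    have ZW: "Z * W \<in> carrier_mat m m" using that W by simp
    have "(B + Z * W)\<^sup>T = B\<^sup>T + W\<^sup>T * Z\<^sup>T"
      by (simp add: transpose_add[OF B ZW] transpose_mult[OF that W])
    then show ?thesis using det_transpose[of "B + Z * W" m] B ZW by simp
  qed
  have "(a \<cdot>\<^sub>m U + b \<cdot>\<^sub>m U')\<^sup>T = a \<cdot>\<^sub>m U\<^sup>T + b \<cdot>\<^sub>m U'\<^sup>T"
    using U U' by (intro eq_matI) auto
  then show ?thesis
    using det_rank_one_linear_right[of "B\<^sup>T" m "W\<^sup>T" "U\<^sup>T" "U'\<^sup>T" a b] tr[OF U] tr[OF U']
      tr[of "a \<cdot>\<^sub>m U + b \<cdot>\<^sub>m U'"] B U U' W det_transpose[OF B] by simp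
qed

text \<open>
  Moving the weight \<open>x\<close> from one index to the other changes only the diagonal terms of the
  bilinear expansion. The coefficients \<open>1\<close> are written out so that both perturbations are
  instances of one combination with weights \<open>a\<close> and \<open>b\<close>.
\<close>

lemma det_rank_one_exchange:
  fixes B :: "'a::idom mat"
  assumes B: "B \<in> carrier_mat m m"
    and U: "U \<in> carrier_mat m 1" and U': "U' \<in> carrier_mat m 1"
    and W: "W \<in> carrier_mat 1 m" and W': "W' \<in> carrier_mat 1 m"
  shows "det (B + (x \<cdot>\<^sub>m U + 1 \<cdot>\<^sub>m U') * (x \<cdot>\<^sub>m W + 1 \<cdot>\<^sub>m W'))
       - det (B + (1 \<cdot>\<^sub>m U + x \<cdot>\<^sub>m U') * (1 \<cdot>\<^sub>m W + x \<cdot>\<^sub>m W'))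
       = (x\<^sup>2 - 1) * (det (B + U * W) - det (B + U' * W'))"
proof -
  define L where "L = (\<lambda>Y Z. det (B + Y * Z) - det B)"
  have L: "L (a \<cdot>\<^sub>m U + b \<cdot>\<^sub>m U') (a \<cdot>\<^sub>m W + b \<cdot>\<^sub>m W')
      = a * (a * L U W + b * L U' W) + b * (a * L U W' + b * L U' W')" for a b
  proof -
    have Y: "a \<cdot>\<^sub>m U + b \<cdot>\<^sub>m U' \<in> carrier_mat m 1" using U U' by simp
    show ?thesis
      unfolding L_def det_rank_one_linear_right[OF B Y W W']
        det_rank_one_linear_left[OF B U U' W] det_rank_one_linear_left[OF B U U' W'] ..
  qed
  have "L (x \<cdot>\<^sub>m U + 1 \<cdot>\<^sub>m U') (x \<cdot>\<^sub>m W + 1 \<cdot>\<^sub>m W') - L (1 \<cdot>\<^sub>m U + x \<cdot>\<^sub>m U') (1 \<cdot>\<^sub>m W + x \<cdot>\<^sub>m W')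
      = (x\<^sup>2 - 1) * (L U W - L U' W')"
    unfolding L by (simp add: power2_eq_square algebra_simps)
  then show ?thesis by (simp add: L_def)
qed

section \<open>The generators as rank-one perturbations of the identity\<close>

definition twin_col :: "nat \<Rightarrow> nat \<Rightarrow> ratfun mat" where
  "twin_col n i = mat (n - 1) 1 (\<lambda>(r, c). twin_coeff i r)"

definition twin_row :: "nat \<Rightarrow> nat \<Rightarrow> ratfun mat" where
  "twin_row n i = mat 1 (n - 1) (\<lambda>(r, c). of_bool (i - 1 = c))"

lemma twin_col_carrier: "twin_col n i \<in> carrier_mat (n - 1) 1"
  and twin_row_carrier: "twin_row n i \<in> carrier_mat 1 (n - 1)"
  by (simp_all add: twin_col_def twin_row_def)

lemma twin_mat_rank_one:
  assumes i: "i \<in> {1..n - 1}"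
  shows "twin_mat n i = 1\<^sub>m (n - 1) + twin_col n i * twin_row n i"
proof (rule eq_matI)
  fix r c
  assume "r < dim_row (1\<^sub>m (n - 1) + twin_col n i * twin_row n i)"
    "c < dim_col (1\<^sub>m (n - 1) + twin_col n i * twin_row n i)"
  then have r: "r < n - 1" and c: "c < n - 1" by (auto simp: twin_col_def twin_row_def)
  then show "twin_mat n i $$ (r, c) = (1\<^sub>m (n - 1) + twin_col n i * twin_row n i) $$ (r, c)"
    unfolding twin_mat_index[OF i r c]
    by (simp add: twin_col_def twin_row_def scalar_prod_def)
qed (simp_all add: twin_mat_def twin_col_def twin_row_def)

text \<open>
  Acting from the left, \<open>V\<^sub>i\<close> negates row \<open>i\<close> and adds \<open>x\<close> times it to its neighbours, so the
  triple product differs from the identity only through the rows \<open>e\<^sub>i\<close> and \<open>e\<^sub>j\<close>. The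
  \<open>2 \<times> 2\<close> coefficient matrix with respect to \<open>u\<^sub>i, u\<^sub>j\<close> and \<open>e\<^sub>i, e\<^sub>j\<close>
  has rows \<open>(x\<^sup>2, x)\<close> and \<open>(x, 1)\<close>, hence rank one.
\<close>

lemma twin_mat_triple:
  assumes i: "i \<in> {1..n - 1}" and j: "j \<in> {1..n - 1}" and ij: "j = i + 1 \<or> i = j + 1"
  shows "twin_mat n i * (twin_mat n j * twin_mat n i) = 1\<^sub>m (n - 1)
      + (ratfun_X \<cdot>\<^sub>m twin_col n i + 1 \<cdot>\<^sub>m twin_col n j)
        * (ratfun_X \<cdot>\<^sub>m twin_row n i + 1 \<cdot>\<^sub>m twin_row n j)" (is "?L = ?R")
proof (rule eq_matI)
  fix r c assume "r < dim_row ?R" "c < dim_col ?R"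
  then have r: "r < n - 1" and c: "c < n - 1" by (auto simp: twin_row_def twin_col_def)
  have i1: "i - 1 < n - 1" and j1: "j - 1 < n - 1" using i j by auto
  have co: "twin_coeff i (i - 1) = - 2" "twin_coeff i (j - 1) = ratfun_X"
    "twin_coeff j (i - 1) = ratfun_X"
    using i j ij by (auto simp: twin_coeff_def)
  have P: "twin_mat n j * twin_mat n i \<in> carrier_mat (n - 1) (n - 1)"
    using twin_mat_carrier[of n i] twin_mat_carrier[of n j] by simp
  have "?R $$ (r, c) = of_bool (r = c) + (ratfun_X * twin_coeff i r + twin_coeff j r)
      * (ratfun_X * of_bool (i - 1 = c) + of_bool (j - 1 = c))"
    using r c by (simp add: twin_col_def twin_row_def scalar_prod_def)
  then show "?L $$ (r, c) = ?R $$ (r, c)"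
    unfolding twin_mat_mult_index[OF i P r c] twin_mat_mult_index[OF j twin_mat_carrier r c]
      twin_mat_mult_index[OF j twin_mat_carrier i1 c] twin_mat_index[OF i r c]
      twin_mat_index[OF i i1 c] twin_mat_index[OF i j1 c] co
    by (simp add: algebra_simps)
qed (use twin_mat_carrier[of n i] in \<open>auto simp: twin_row_def twin_col_def\<close>)

section \<open>The skein relation\<close>

text \<open>
  The factors \<open>A\<close> and \<open>B\<close> are absorbed into the column and the row, so that the
  perturbed matrix \<open>A * B - 1\<^sub>m m\<close> is the same for every \<open>U\<close> and \<open>W\<close>.
\<close>

lemma sandwich_rank_one:
  fixes A :: "'a::comm_ring_1 mat"
  assumes A: "A \<in> carrier_mat m m" and B: "B \<in> carrier_mat m m"
    and U: "U \<in> carrier_mat m 1" and W: "W \<in> carrier_mat 1 m"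
  shows "A * (1\<^sub>m m + U * W) * B - 1\<^sub>m m = (A * B - 1\<^sub>m m) + (A * U) * (W * B)"
proof -
  have UW: "U * W \<in> carrier_mat m m" and AU: "A * U \<in> carrier_mat m 1"
    and AUW: "A * (U * W) \<in> carrier_mat m m"
    using A U W by auto
  have "A * (1\<^sub>m m + U * W) * B = (A + A * (U * W)) * B"
    using A by (simp add: mult_add_distrib_mat[OF A one_carrier_mat UW])
  also have "\<dots> = A * B + A * (U * W) * B" by (rule add_mult_distrib_mat[OF A AUW B])
  also have "A * (U * W) * B = (A * U) * (W * B)"
    unfolding assoc_mult_mat[OF A U W, symmetric] by (rule assoc_mult_mat[OF AU W B])
  finally have "A * (1\<^sub>m m + U * W) * B = A * B + (A * U) * (W * B)" .
  moreover have "(A * U) * (W * B) \<in> carrier_mat m m" using A U W B by auto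
  ultimately show ?thesis using A B by (intro eq_matI) auto
qed

lemma det_twin_skein:
  assumes i: "i \<in> {1..n - 1}" and j: "j \<in> {1..n - 1}" and ij: "j = i + 1"
    and A: "A \<in> carrier_mat (n - 1) (n - 1)" and B: "B \<in> carrier_mat (n - 1) (n - 1)"
  shows "det (A * (twin_mat n i * (twin_mat n j * twin_mat n i)) * B - 1\<^sub>m (n - 1))
       - det (A * (twin_mat n j * (twin_mat n i * twin_mat n j)) * B - 1\<^sub>m (n - 1))
       = (ratfun_X\<^sup>2 - 1) * (det (A * twin_mat n i * B - 1\<^sub>m (n - 1))
         - det (A * twin_mat n j * B - 1\<^sub>m (n - 1)))"
proof -
  let ?m = "n - 1" and ?x = ratfun_X
  let ?U = "twin_col n i" and ?U' = "twin_col n j" and ?W = "twin_row n i" and ?W' = "twin_row n j"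
  note cr = twin_col_carrier[of n] twin_row_carrier[of n]
  have comb: "a \<cdot>\<^sub>m ?U + b \<cdot>\<^sub>m ?U' \<in> carrier_mat ?m 1" "a \<cdot>\<^sub>m ?W + b \<cdot>\<^sub>m ?W' \<in> carrier_mat 1 ?m"
    for a b
    using cr by auto
  have left: "A * (a \<cdot>\<^sub>m ?U + b \<cdot>\<^sub>m ?U') = a \<cdot>\<^sub>m (A * ?U) + b \<cdot>\<^sub>m (A * ?U')" for a b
    unfolding mult_add_distrib_mat[OF A smult_carrier_mat[OF cr(1)] smult_carrier_mat[OF cr(1)]]
      mult_smult_distrib[OF A cr(1)] ..
  have right: "(a \<cdot>\<^sub>m ?W + b \<cdot>\<^sub>m ?W') * B = a \<cdot>\<^sub>m (?W * B) + b \<cdot>\<^sub>m (?W' * B)" for a b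
    unfolding add_mult_distrib_mat[OF smult_carrier_mat[OF cr(2)] smult_carrier_mat[OF cr(2)] B]
      mult_smult_assoc_mat[OF cr(2) B] ..
  have triple_i: "twin_mat n i * (twin_mat n j * twin_mat n i) = 1\<^sub>m ?m
      + (?x \<cdot>\<^sub>m ?U + 1 \<cdot>\<^sub>m ?U') * (?x \<cdot>\<^sub>m ?W + 1 \<cdot>\<^sub>m ?W')"
    using twin_mat_triple[OF i j] ij by blast
  (* The triple product centred at i, with its summands put in the order i, j. *)
  have triple_j: "twin_mat n j * (twin_mat n i * twin_mat n j) = 1\<^sub>m ?m
      + (1 \<cdot>\<^sub>m ?U + ?x \<cdot>\<^sub>m ?U') * (1 \<cdot>\<^sub>m ?W + ?x \<cdot>\<^sub>m ?W')"
    using twin_mat_triple[OF j i] ij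
      comm_add_mat[of "?x \<cdot>\<^sub>m ?U'" ?m 1 "1 \<cdot>\<^sub>m ?U"] comm_add_mat[of "?x \<cdot>\<^sub>m ?W'" 1 ?m "1 \<cdot>\<^sub>m ?W"] cr
    by (metis smult_carrier_mat)
  have ABm: "A * B - 1\<^sub>m ?m \<in> carrier_mat ?m ?m"
    by (rule minus_carrier_mat[OF one_carrier_mat])
  have prods: "A * ?U \<in> carrier_mat ?m 1" "A * ?U' \<in> carrier_mat ?m 1"
    "?W * B \<in> carrier_mat 1 ?m" "?W' * B \<in> carrier_mat 1 ?m"
    by (rule mult_carrier_mat[OF A cr(1)] mult_carrier_mat[OF cr(2) B])+
  show ?thesis
    unfolding triple_i triple_j
    unfolding twin_mat_rank_one[OF i] twin_mat_rank_one[OF j]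
    by (simp only: sandwich_rank_one[OF A B comb] sandwich_rank_one[OF A B cr] left right
        det_rank_one_exchange[OF ABm prods])
qed

theorem proposition4p11:
  fixes n i :: nat and \<alpha> \<beta> :: "nat word set"
  assumes "n \<ge> 3" and "1 \<le> i" and "i \<le> n - 2"
    and "\<alpha> \<in> carrier (twin_group n)" and "\<beta> \<in> carrier (twin_group n)"
  shows "twin_f n (\<alpha> \<otimes>\<^bsub>twin_group n\<^esub> twin_gen n i \<otimes>\<^bsub>twin_group n\<^esub> twin_gen n (i + 1)
             \<otimes>\<^bsub>twin_group n\<^esub> twin_gen n i \<otimes>\<^bsub>twin_group n\<^esub> \<beta>)
       - twin_f n (\<alpha> \<otimes>\<^bsub>twin_group n\<^esub> twin_gen n (i + 1) \<otimes>\<^bsub>twin_group n\<^esub> twin_gen n i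
             \<otimes>\<^bsub>twin_group n\<^esub> twin_gen n (i + 1) \<otimes>\<^bsub>twin_group n\<^esub> \<beta>)
       = (ratfun_X\<^sup>2 - 1) *
         (twin_f n (\<alpha> \<otimes>\<^bsub>twin_group n\<^esub> twin_gen n i \<otimes>\<^bsub>twin_group n\<^esub> \<beta>)
          - twin_f n (\<alpha> \<otimes>\<^bsub>twin_group n\<^esub> twin_gen n (i + 1) \<otimes>\<^bsub>twin_group n\<^esub> \<beta>))"
proof -
  let ?j = "i + 1"
  interpret T: group "twin_group n" by (rule twin_group_group)
  have i: "i \<in> {1..n - 1}" and j: "?j \<in> {1..n - 1}" using assms(1-3) by auto
  note mult = hom_mult[OF twin_rep_hom, unfolded GL_simps]
  have carr: "twin_rep n \<gamma> \<in> carrier_mat (n - 1) (n - 1)" if "\<gamma> \<in> carrier (twin_group n)" for \<gamma>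
    using hom_carrier[OF twin_rep_hom[of n]] that
    by (auto simp: GL_def units_of_def Units_def ring_mat_simps)
  define A where "A = twin_rep n \<alpha>"
  define B where "B = twin_rep n \<beta>"
  have A: "A \<in> carrier_mat (n - 1) (n - 1)" and B: "B \<in> carrier_mat (n - 1) (n - 1)"
    using carr assms(4,5) by (auto simp: A_def B_def)
  note V = twin_mat_carrier[of n]
  have one: "twin_rep n (\<alpha> \<otimes>\<^bsub>twin_group n\<^esub> twin_gen n k \<otimes>\<^bsub>twin_group n\<^esub> \<beta>) = A * twin_mat n k * B"
    if k: "k \<in> {1..n - 1}" for k
    using assms(4,5) twin_gen_carrier[OF k] by (simp add: mult twin_rep_gen[OF k] A_def B_def)
  have three: "twin_rep n (\<alpha> \<otimes>\<^bsub>twin_group n\<^esub> twin_gen n k \<otimes>\<^bsub>twin_group n\<^esub> twin_gen n l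
        \<otimes>\<^bsub>twin_group n\<^esub> twin_gen n k \<otimes>\<^bsub>twin_group n\<^esub> \<beta>)
      = A * (twin_mat n k * (twin_mat n l * twin_mat n k)) * B"
    if k: "k \<in> {1..n - 1}" and l: "l \<in> {1..n - 1}" for k l
  proof -
    have "A * twin_mat n k * twin_mat n l * twin_mat n k
        = A * (twin_mat n k * (twin_mat n l * twin_mat n k))"
      using A V[of k] V[of l] by (simp add: assoc_mult_mat[of _ "n - 1" "n - 1" _ "n - 1" _ "n - 1"])
    then show ?thesis
      using assms(4,5) twin_gen_carrier[OF k] twin_gen_carrier[OF l]
      by (simp add: mult twin_rep_gen[OF k] twin_rep_gen[OF l] A_def B_def)
  qed
  have n: "n \<noteq> 1" using assms(1) by simp
  show ?thesis
    unfolding twin_f_def one[OF i] one[OF j] three[OF i j] three[OF j i] if_not_P[OF n]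
      diff_divide_distrib[symmetric] det_twin_skein[OF i j refl A B] by simp
qed

end
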